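(* Let $d$ be even, let $\Gamma\subseteq\mathrm{Sym}(N)$ be a permutation group, let $v\in\mathcal{S}_d(\Gamma)$ be an irreducible arrangement, and let $\tau\in\mathrm{O}(\mathbb{R}^d)\setminus\mathrm{SO}(\mathbb{R}^d)$, i.e. $\det(\tau)=-1$. Then $v$ and $\tau v:=(\tau v_i)_{i\in N}$ are not deformation equivalent.
   Context: Let $n,d\ge 1$ and $N=\{1,\dots,n\}$. A $d$-dimensional arrangement is a family of points $v_i\in\mathbb{R}^d$, $i\in N$; its matrix $M\in\mathbb{R}^{n\times d}$ has $i$-th row $v_i^\top$. It is normalized if $M^\top M=\mathrm{Id}$. For a permutation group $\Gamma\subseteq\mathrm{Sym}(N)$, $v$ is a $\Gamma$-arrangement if there is a group homomorphism $T\colon\Gamma\to\mathrm{O}(\mathbb{R}^d)$ with $T_\phi v_i=v_{\phi(i)}$ for all $i\in N$, $\phi\in\Gamma$; $T$ is called the representation of $v$ (it is unique if the $v_i$ span $\mathbb{R}^d$, in particular if $v$ is normalized). $v$ is irreducible if its representation is irreducible over $\mathbb{R}$. $\mathcal{S}_d(\Gamma)$ is the set of $d$-dimensional normalized $\Gamma$-arrangements on $N$, with the subspace topology from $(\mathbb{R}^d)^n$. Two arrangements $v,\bar v\in\mathcal{S}_d(\Gamma)$ are deformation equivalent if there is a continuous map $v(\cdot)\colon[0,1]\to\mathcal{S}_d(\Gamma)$ with $v(0)=v$ and $v(1)=\bar v$. *)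

theory Defs
  imports "HOL-Analysis.Analysis" "HOL-Algebra.Bij"
begin

text \<open>
  The index set $N$ is the universe of a finite type \<open>'n\<close>, and $\mathrm{Sym}(N)$ is
  \<open>BijGroup UNIV\<close>. An arrangement is a \<open>real ^ 'd ^ 'n\<close>: its \<open>i\<close>-th component \<open>v $ i\<close> is the
  point $v_i$, and since this is also the \<open>i\<close>-th row, the same object is its matrix $M$.
\<close>

definition orthogonal_group :: "(real ^ 'd ^ 'd) monoid" where
  "orthogonal_group = \<lparr>carrier = {A. orthogonal_matrix A}, mult = (**), one = mat 1\<rparr>"

definition normalized_arrangement :: "real ^ 'd ^ 'n \<Rightarrow> bool" where
  "normalized_arrangement v \<longleftrightarrow> transpose v ** v = mat 1"

definition representation_of ::
  "('n \<Rightarrow> 'n) set \<Rightarrow> real ^ 'd ^ 'n \<Rightarrow> (('n \<Rightarrow> 'n) \<Rightarrow> real ^ 'd ^ 'd) \<Rightarrow> bool" where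
  "representation_of \<Gamma> v T \<longleftrightarrow>
     T \<in> hom (BijGroup UNIV \<lparr>carrier := \<Gamma>\<rparr>) orthogonal_group \<and>
     (\<forall>\<phi>\<in>\<Gamma>. \<forall>i. T \<phi> *v (v $ i) = v $ \<phi> i)"

definition symmetric_arrangement :: "('n \<Rightarrow> 'n) set \<Rightarrow> real ^ 'd ^ 'n \<Rightarrow> bool" where
  "symmetric_arrangement \<Gamma> v \<longleftrightarrow> (\<exists>T. representation_of \<Gamma> v T)"

text \<open>Since \<open>real ^ 'd\<close> is never the zero space, its being nonzero need not be required.\<close>

definition irreducible_representation ::
  "('n \<Rightarrow> 'n) set \<Rightarrow> (('n \<Rightarrow> 'n) \<Rightarrow> real ^ 'd ^ 'd) \<Rightarrow> bool" where
  "irreducible_representation \<Gamma> T \<longleftrightarrow>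
     (\<forall>W. subspace W \<and> (\<forall>\<phi>\<in>\<Gamma>. \<forall>w\<in>W. T \<phi> *v w \<in> W) \<longrightarrow> W = {0} \<or> W = UNIV)"

text \<open>
  For a normalized arrangement the representation is unique on \<open>\<Gamma>\<close>
  (see \<open>representation_of_unique\<close>), so the existential picks out ``the'' representation.
\<close>

definition irreducible_arrangement :: "('n \<Rightarrow> 'n) set \<Rightarrow> real ^ 'd ^ 'n \<Rightarrow> bool" where
  "irreducible_arrangement \<Gamma> v \<longleftrightarrow>
     (\<exists>T. representation_of \<Gamma> v T \<and> irreducible_representation \<Gamma> T)"

definition normalized_arrangements :: "('n \<Rightarrow> 'n) set \<Rightarrow> (real ^ 'd ^ 'n) set" where
  "normalized_arrangements \<Gamma> = {v. normalized_arrangement v \<and> symmetric_arrangement \<Gamma> v}"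

text \<open>
  \<open>path_component S v w\<close> says that a continuous map from $[0,1]$ into \<open>S\<close> leads from \<open>v\<close> to \<open>w\<close>;
  in particular both \<open>v\<close> and \<open>w\<close> lie in \<open>S\<close>.
\<close>

definition deformation_equivalent ::
  "('n \<Rightarrow> 'n) set \<Rightarrow> real ^ 'd ^ 'n \<Rightarrow> real ^ 'd ^ 'n \<Rightarrow> bool" where
  "deformation_equivalent \<Gamma> v w \<longleftrightarrow> path_component (normalized_arrangements \<Gamma>) v w"

definition transform_arrangement ::
  "real ^ 'd ^ 'd \<Rightarrow> real ^ 'd ^ 'n \<Rightarrow> real ^ 'd ^ 'n" where
  "transform_arrangement \<tau> v = (\<chi> i. \<tau> *v (v $ i))"

lemma representation_of_unique:
  fixes v :: "real ^ 'd ^ 'n"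
  assumes v: "normalized_arrangement v"
    and T: "representation_of \<Gamma> v T" and T': "representation_of \<Gamma> v T'"
    and \<phi>: "\<phi> \<in> \<Gamma>"
  shows "T \<phi> = T' \<phi>"
proof -
  have eq: "v ** transpose (T \<phi>) = v ** transpose (T' \<phi>)"
  proof -
    have "T \<phi> *v (v $ i) = T' \<phi> *v (v $ i)" for i
      using T T' \<phi> by (simp add: representation_of_def)
    then show ?thesis
      by (simp add: vec_eq_iff matrix_matrix_mult_def matrix_vector_mult_def transpose_def mult.commute)
  qed
  have "transpose v ** (v ** transpose (T \<phi>)) = transpose v ** (v ** transpose (T' \<phi>))"
    by (simp only: eq)
  then show ?thesis
    using v by (simp add: matrix_mul_assoc normalized_arrangement_def)
qed

end

theory Submission
  imports Defs
begin

text \<open>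
  A deformation changes the representation of an arrangement only by a change of basis of positive
  determinant. Indeed, for normalized \<open>\<Gamma>\<close>-arrangements \<open>v\<close> and \<open>w\<close> the matrix
  \<open>transpose w ** v\<close> intertwines their representations (\<open>transpose_mult_intertwines\<close>), and it
  is the identity for \<open>w = v\<close>. Hence all \<open>w\<close> close to \<open>v\<close> have an intertwiner with \<open>v\<close> of
  positive determinant. Having such an intertwiner is an equivalence relation, so it propagates
  along connected sets and in particular along deformations
  (\<open>deformation_equivalent_imp_positively_intertwined\<close>).

  If \<open>v\<close>, with representation \<open>T\<close>, could be deformed into \<open>\<tau> v\<close>, there would be an \<open>X\<close> of
  positive determinant taking \<open>T\<close> to the representation of \<open>\<tau> v\<close>, which is \<open>T\<close> conjugated by
  \<open>\<tau>\<close>. Then \<open>transpose \<tau> ** X\<close> would commute with \<open>T\<close> and have negative determinant. For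
  irreducible \<open>T\<close> in even dimension this is impossible (\<open>irreducible_commutant_det_nonneg\<close>):
  the commutant is a division algebra over the reals, and unless an element is a scalar it can be
  joined to the identity by a segment of invertible matrices.
\<close>

text \<open>
  The representation solved from \<open>P v = v ** transpose (T \<phi>)\<close>, where \<open>P\<close> permutes the rows by
  \<open>\<phi>\<close>. The explicit formula makes sense for every \<open>v\<close>, which avoids choosing a
  representation at each point of a deformation.
\<close>

definition induced_rep :: "real ^ 'd ^ 'n \<Rightarrow> ('n \<Rightarrow> 'n) \<Rightarrow> real ^ 'd ^ 'd" where
  "induced_rep v \<phi> = transpose (\<chi> i. v $ \<phi> i) ** v"

lemma rows_permuted_by_representation:
  assumes "representation_of \<Gamma> v T" "\<phi> \<in> \<Gamma>"
  shows "(\<chi> i. v $ \<phi> i) = v ** transpose (T \<phi>)"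
proof -
  have "T \<phi> *v (v $ i) = v $ \<phi> i" for i
    using assms by (simp add: representation_of_def)
  then show ?thesis
    by (simp add: vec_eq_iff matrix_matrix_mult_def matrix_vector_mult_def transpose_def mult.commute)
qed

lemma representation_of_eq_induced_rep:
  fixes v :: "real ^ 'd ^ 'n"
  assumes v: "normalized_arrangement v"
    and T: "representation_of \<Gamma> v T" and \<phi>: "\<phi> \<in> \<Gamma>"
  shows "T \<phi> = induced_rep v \<phi>"
  using v unfolding induced_rep_def rows_permuted_by_representation[OF T \<phi>]
  by (simp add: matrix_transpose_mul matrix_mul_assoc[symmetric] normalized_arrangement_def)

lemma rows_permuted_by_induced_rep:
  fixes v :: "real ^ 'd ^ 'n"
  assumes "v \<in> normalized_arrangements \<Gamma>" and "\<phi> \<in> \<Gamma>"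
  shows "(\<chi> i. v $ \<phi> i) = v ** transpose (induced_rep v \<phi>)"
  using assms rows_permuted_by_representation representation_of_eq_induced_rep
  by (metis (mono_tags, lifting) mem_Collect_eq normalized_arrangements_def symmetric_arrangement_def)

lemma orthogonal_matrix_induced_rep:
  fixes v :: "real ^ 'd ^ 'n"
  assumes "v \<in> normalized_arrangements \<Gamma>" and "\<phi> \<in> \<Gamma>"
  shows "orthogonal_matrix (induced_rep v \<phi>)"
proof -
  obtain T where v: "normalized_arrangement v" and T: "representation_of \<Gamma> v T"
    using assms by (auto simp: normalized_arrangements_def symmetric_arrangement_def)
  have "orthogonal_matrix (T \<phi>)"
    using T assms(2) by (auto simp: representation_of_def hom_def orthogonal_group_def)
  then show ?thesis
    using representation_of_eq_induced_rep[OF v T assms(2)] by simp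
qed

lemma transform_arrangement_eq_mult:
  "transform_arrangement \<tau> v = v ** transpose \<tau>"
  by (simp add: transform_arrangement_def vec_eq_iff matrix_matrix_mult_def
      matrix_vector_mult_def transpose_def mult.commute)

lemma induced_rep_transform_arrangement:
  fixes v :: "real ^ 'd ^ 'n"
  shows "induced_rep (transform_arrangement \<tau> v) \<phi> = \<tau> ** induced_rep v \<phi> ** transpose \<tau>"
proof -
  have "(\<chi> i. transform_arrangement \<tau> v $ \<phi> i) = (\<chi> i. v $ \<phi> i) ** transpose \<tau>"
    by (simp add: transform_arrangement_def vec_eq_iff matrix_matrix_mult_def
        matrix_vector_mult_def transpose_def mult.commute)
  then show ?thesis
    by (simp add: induced_rep_def transform_arrangement_eq_mult matrix_transpose_mul
        matrix_mul_assoc)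
qed

lemma transpose_mult_permute_rows:
  fixes v w :: "real ^ 'd ^ 'n"
  assumes "bij \<phi>"
  shows "transpose (\<chi> i. w $ \<phi> i) ** (\<chi> i. v $ \<phi> i) = transpose w ** v"
  by (simp add: vec_eq_iff matrix_matrix_mult_def transpose_def
      sum.reindex_bij_betw[OF assms, where g = "\<lambda>i. w $ i $ _ * v $ i $ _"])

text \<open>
  Permuting the rows of both arrangements by \<open>\<phi>\<close> leaves \<open>transpose w ** v\<close> unchanged, but it
  also multiplies \<open>transpose w ** v\<close> by the two representing matrices, one on each side, the one
  of \<open>v\<close> transposed. As that matrix is orthogonal it can be moved to the other side.
\<close>

lemma transpose_mult_intertwines:
  fixes v w :: "real ^ 'd ^ 'n"
  assumes v: "v \<in> normalized_arrangements \<Gamma>" and w: "w \<in> normalized_arrangements \<Gamma>"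
    and \<phi>: "\<phi> \<in> \<Gamma>" "bij \<phi>"
  shows "(transpose w ** v) ** induced_rep v \<phi> = induced_rep w \<phi> ** (transpose w ** v)"
proof -
  let ?A = "induced_rep v \<phi>" and ?B = "induced_rep w \<phi>"
  have "transpose w ** v = transpose (w ** transpose ?B) ** (v ** transpose ?A)"
    using transpose_mult_permute_rows[OF \<phi>(2), of w v]
    by (simp add: rows_permuted_by_induced_rep[OF v \<phi>(1)] rows_permuted_by_induced_rep[OF w \<phi>(1)])
  also have "\<dots> = ?B ** (transpose w ** v) ** transpose ?A"
    by (simp add: matrix_transpose_mul matrix_mul_assoc)
  finally have "(transpose w ** v) ** ?A = ?B ** (transpose w ** v) ** (transpose ?A ** ?A)"
    by (metis matrix_mul_assoc)
  then show ?thesis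
    using orthogonal_matrix_induced_rep[OF v \<phi>(1)] by (simp add: orthogonal_matrix)
qed

text \<open>
  Positive determinant is required in place of membership in the special orthogonal group: this
  is enough for the final contradiction, and \<open>transpose w ** v\<close> then needs no rescaling.
\<close>

definition positively_intertwined ::
  "('n \<Rightarrow> 'n) set \<Rightarrow> real ^ 'd ^ 'n \<Rightarrow> real ^ 'd ^ 'n \<Rightarrow> bool" where
  "positively_intertwined \<Gamma> v w \<longleftrightarrow>
     (\<exists>X. det X > 0 \<and> (\<forall>\<phi>\<in>\<Gamma>. X ** induced_rep v \<phi> = induced_rep w \<phi> ** X))"

lemma positively_intertwined_sym:
  assumes "positively_intertwined \<Gamma> v w"
  shows "positively_intertwined \<Gamma> w v"
proof -
  obtain X where X: "det X > 0" "\<And>\<phi>. \<phi> \<in> \<Gamma> \<Longrightarrow> X ** induced_rep v \<phi> = induced_rep w \<phi> ** X"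
    using assms by (auto simp: positively_intertwined_def)
  then obtain Y where Y: "X ** Y = mat 1" "Y ** X = mat 1"
    by (metis invertible_def invertible_det_nz less_irrefl)
  have "det X * det Y = 1"
    using Y(1) by (metis det_I det_mul)
  then have "det Y > 0"
    using X(1) by (metis zero_less_mult_pos zero_less_one)
  moreover have "Y ** induced_rep w \<phi> = induced_rep v \<phi> ** Y" if "\<phi> \<in> \<Gamma>" for \<phi>
  proof -
    have "Y ** induced_rep w \<phi> = Y ** (induced_rep w \<phi> ** X) ** Y"
      by (simp add: Y matrix_mul_assoc[symmetric])
    also have "\<dots> = (Y ** X) ** induced_rep v \<phi> ** Y"
      by (simp add: X(2)[OF that, symmetric] matrix_mul_assoc)
    finally show ?thesis
      by (simp add: Y)
  qed
  ultimately show ?thesis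
    by (auto simp: positively_intertwined_def)
qed

lemma positively_intertwined_trans:
  assumes "positively_intertwined \<Gamma> u v" "positively_intertwined \<Gamma> v w"
  shows "positively_intertwined \<Gamma> u w"
proof -
  obtain X Y where X: "det X > 0" "\<And>\<phi>. \<phi> \<in> \<Gamma> \<Longrightarrow> X ** induced_rep u \<phi> = induced_rep v \<phi> ** X"
    and Y: "det Y > 0" "\<And>\<phi>. \<phi> \<in> \<Gamma> \<Longrightarrow> Y ** induced_rep v \<phi> = induced_rep w \<phi> ** Y"
    using assms by (auto simp: positively_intertwined_def)
  have "(Y ** X) ** induced_rep u \<phi> = induced_rep w \<phi> ** (Y ** X)" if "\<phi> \<in> \<Gamma>" for \<phi>
    using X(2)[OF that] Y(2)[OF that] by (metis matrix_mul_assoc)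
  moreover have "det (Y ** X) > 0"
    using X(1) Y(1) by (simp add: det_mul)
  ultimately show ?thesis
    unfolding positively_intertwined_def by blast
qed

lemma continuous_on_det [continuous_intros]:
  fixes f :: "'a::topological_space \<Rightarrow> real ^ 'd ^ 'd"
  assumes "continuous_on S f"
  shows "continuous_on S (\<lambda>x. det (f x))"
  unfolding det_def by (intro continuous_intros assms)

text \<open>
  The intertwiner \<open>transpose w ** v\<close> depends continuously on \<open>w\<close> and has determinant 1 at
  \<open>w = v\<close>, by normalization.
\<close>

lemma positively_intertwined_nearby:
  fixes v :: "real ^ 'd ^ 'n"
  assumes \<Gamma>: "subgroup \<Gamma> (BijGroup UNIV)" and v: "v \<in> normalized_arrangements \<Gamma>"
  obtains U where "open U" "v \<in> U"
    "\<And>w. w \<in> U \<inter> normalized_arrangements \<Gamma> \<Longrightarrow> positively_intertwined \<Gamma> v w"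
proof
  let ?U = "{w :: real ^ 'd ^ 'n. 0 < det (transpose w ** v)}"
  show "open ?U"
    unfolding matrix_matrix_mult_def transpose_def
    by (intro open_Collect_less continuous_intros)
  show "v \<in> ?U"
    using v by (simp add: normalized_arrangements_def normalized_arrangement_def)
  have "bij \<phi>" if "\<phi> \<in> \<Gamma>" for \<phi>
    using subgroup.subset[OF \<Gamma>] that by (auto simp: BijGroup_def Bij_def)
  then show "positively_intertwined \<Gamma> v w" if "w \<in> ?U \<inter> normalized_arrangements \<Gamma>" for w
    using that v transpose_mult_intertwines[of v \<Gamma> w] unfolding positively_intertwined_def by blast
qed

lemma deformation_equivalent_imp_positively_intertwined:
  fixes v w :: "real ^ 'd ^ 'n"
  assumes \<Gamma>: "subgroup \<Gamma> (BijGroup UNIV)" and "deformation_equivalent \<Gamma> v w"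
  shows "positively_intertwined \<Gamma> v w"
proof -
  obtain S where S: "connected S" "S \<subseteq> normalized_arrangements \<Gamma>" "v \<in> S" "w \<in> S"
    using assms(2) unfolding deformation_equivalent_def path_component_def
    by (metis connected_path_image pathfinish_in_path_image pathstart_in_path_image)
  show ?thesis
  proof (rule connected_equivalence_relation[OF S(1,3,4)])
    fix u assume "u \<in> S"
    then obtain U where U: "open U" "u \<in> U"
      "\<And>w. w \<in> U \<inter> normalized_arrangements \<Gamma> \<Longrightarrow> positively_intertwined \<Gamma> u w"
      using positively_intertwined_nearby[OF \<Gamma>] S(2) by blast
    then show "\<exists>V. openin (top_of_set S) V \<and> u \<in> V \<and> (\<forall>x\<in>V. positively_intertwined \<Gamma> u x)"
      using S(2) \<open>u \<in> S\<close> by (intro exI[of _ "S \<inter> U"]) (auto simp: openin_open)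
  qed (use positively_intertwined_sym positively_intertwined_trans in blast)+
qed

lemma det_scaleR_mat_1: "det (c *\<^sub>R mat 1 :: real ^ 'd ^ 'd) = c ^ CARD('d)"
  by (subst det_diagonal) (auto simp: mat_def)

text \<open>
  If \<open>det B < 0\<close>, then some matrix on the segment from \<open>B\<close> to the identity is singular. Its kernel
  is invariant, hence the whole space by irreducibility, which makes \<open>B\<close> a scalar matrix; in even
  dimension a scalar matrix has nonnegative determinant.
\<close>

lemma irreducible_commutant_det_nonneg:
  fixes B :: "real ^ 'd ^ 'd"
  assumes d: "even CARD('d)"
    and irr: "irreducible_representation \<Gamma> T"
    and comm: "\<And>\<phi>. \<phi> \<in> \<Gamma> \<Longrightarrow> B ** T \<phi> = T \<phi> ** B"
  shows "det B \<ge> 0"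
proof (rule ccontr)
  assume neg: "\<not> det B \<ge> 0"
  define C where "C s = (1 - s) *\<^sub>R B + s *\<^sub>R mat 1" for s
  have "\<exists>s\<ge>0. s \<le> 1 \<and> det (C s) = 0"
    using neg by (intro IVT') (auto simp: C_def intro!: continuous_intros)
  then obtain s where s: "det (C s) = 0"
    by blast
  have C_apply: "C s *v x = (1 - s) *\<^sub>R (B *v x) + s *\<^sub>R x" for x
    by (simp add: C_def matrix_vector_mult_add_rdistrib scaleR_matrix_vector_assoc[symmetric])
  let ?W = "{x. C s *v x = 0}"
  have "subspace ?W"
    by (auto simp: subspace_def matrix_vector_right_distrib matrix_vector_mult_scaleR)
  moreover have "T \<phi> *v x \<in> ?W" if "\<phi> \<in> \<Gamma>" "x \<in> ?W" for \<phi> x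
  proof -
    have "C s *v (T \<phi> *v x) = T \<phi> *v (C s *v x)"
      unfolding C_apply
      by (simp add: matrix_vector_right_distrib matrix_vector_mult_scaleR
          matrix_vector_mul_assoc comm[OF that(1)])
    then show ?thesis
      using that(2) by simp
  qed
  moreover have "?W \<noteq> {0}"
  proof -
    have "\<not> invertible (C s)"
      using s by (simp add: invertible_det_nz)
    then obtain x where "C s *v x = 0" "x \<noteq> 0"
      by (metis invertible_left_inverse matrix_left_invertible_ker)
    then show ?thesis
      by blast
  qed
  ultimately have "?W = UNIV"
    using irr unfolding irreducible_representation_def by blast
  then have "C s = 0"
    by (metis (mono_tags, lifting) UNIV_I matrix_eq matrix_vector_mult_0 mem_Collect_eq)
  then have B: "(1 - s) *\<^sub>R B = (- s) *\<^sub>R mat 1"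
    by (simp add: C_def eq_neg_iff_add_eq_0)
  have "s \<noteq> 1"
    using s by (auto simp: C_def)
  have "B = (- s / (1 - s)) *\<^sub>R mat 1"
    using arg_cong[OF B, of "\<lambda>A. (1 / (1 - s)) *\<^sub>R A"] \<open>s \<noteq> 1\<close> by simp
  then have "det B = (- s / (1 - s)) ^ CARD('d)"
    by (simp only: det_scaleR_mat_1)
  then show False
    using neg d by (metis zero_le_even_power)
qed

theorem corollary5p9:
  fixes \<Gamma> :: "('n::finite \<Rightarrow> 'n) set"
    and v :: "real ^ 'd ^ 'n"
    and \<tau> :: "real ^ 'd ^ 'd"
  assumes "even CARD('d)"
    and "subgroup \<Gamma> (BijGroup UNIV)"
    and "v \<in> normalized_arrangements \<Gamma>"
    and "irreducible_arrangement \<Gamma> v"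
    and "orthogonal_matrix \<tau>" and "det \<tau> = -1"
  shows "\<not> deformation_equivalent \<Gamma> v (transform_arrangement \<tau> v)"
proof
  assume "deformation_equivalent \<Gamma> v (transform_arrangement \<tau> v)"
  then have "positively_intertwined \<Gamma> v (transform_arrangement \<tau> v)"
    by (rule deformation_equivalent_imp_positively_intertwined[OF assms(2)])
  then obtain X where X: "det X > 0"
    and "\<And>\<phi>. \<phi> \<in> \<Gamma> \<Longrightarrow> X ** induced_rep v \<phi> = \<tau> ** induced_rep v \<phi> ** transpose \<tau> ** X"
    by (auto simp: positively_intertwined_def induced_rep_transform_arrangement)
  then have comm: "(transpose \<tau> ** X) ** induced_rep v \<phi> = induced_rep v \<phi> ** (transpose \<tau> ** X)"
    if "\<phi> \<in> \<Gamma>" for \<phi>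
    using that \<open>orthogonal_matrix \<tau>\<close>
    by (metis matrix_mul_assoc matrix_mul_lid orthogonal_matrix)
  obtain T where T: "representation_of \<Gamma> v T" "irreducible_representation \<Gamma> T"
    using assms(4) by (auto simp: irreducible_arrangement_def)
  have "T \<phi> = induced_rep v \<phi>" if "\<phi> \<in> \<Gamma>" for \<phi>
    using representation_of_eq_induced_rep[OF _ T(1) that] assms(3)
    by (simp add: normalized_arrangements_def)
  then have "det (transpose \<tau> ** X) \<ge> 0"
    using irreducible_commutant_det_nonneg[OF assms(1) T(2)] comm by simp
  then show False
    using X \<open>det \<tau> = -1\<close> by (simp add: det_mul)
qed

end
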